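(* Let $G$ be a finite nontrivial group and let $d_{\min}$ denote the smallest dimension of a nontrivial irreducible complex representation of $G$. Let $d_\psi \ge 1$ be an integer and let $\psi : G \to \mathsf{U}_{d_\psi}$ be any function. Then $$\mathbb{E}_{x,y \in G} \left\| \psi(xy) - \psi(x)\,\psi(y) \right\|_{\mathrm F}^2 \;\ge\; 2 d_\psi \left( 1 - \left\| \mathbb{E}_x \psi(x) \right\|_{\mathrm{op}}^3 - \sqrt{\frac{d_\psi}{d_{\min}}} \right).$$
   Context: $\mathsf{U}_d$ is the group of $d\times d$ complex unitary matrices. The function $\psi$ is arbitrary; it is not assumed to be a homomorphism. $\mathbb{E}_x$ and $\mathbb{E}_{x,y}$ denote averages over $x\in G$, respectively over independent pairs $(x,y) \in G\times G$, chosen uniformly at random. $\|A\|_{\mathrm{op}}$ is the operator norm (with respect to the Euclidean norm on $\mathbb{C}^d$), and $\|A\|_{\mathrm F}^2 = \operatorname{tr} A^\dagger A$ is the squared Frobenius norm, where $A^\dagger$ is the conjugate transpose. The trivial representation is the one-dimensional representation sending every group element to $1$. *)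

theory Defs
  imports "Jordan_Normal_Form.VS_Connect" "HOL-Analysis.Analysis" "HOL-Algebra.Group"
begin

no_notation Matrix.vec_index (infixl "$" 100)

definition average :: "'i set \<Rightarrow> ('i \<Rightarrow> 'v::real_vector) \<Rightarrow> 'v" where
  "average S f = (1 / real (card S)) *\<^sub>R (\<Sum>i\<in>S. f i)"

definition conj_transpose :: "complex ^ 'n ^ 'm \<Rightarrow> complex ^ 'm ^ 'n" where
  "conj_transpose A = (\<chi> i j. cnj (A $ j $ i))"

definition unitary_group :: "(complex ^ 'n ^ 'n) set" where
  "unitary_group =
     {U. conj_transpose U ** U = Finite_Cartesian_Product.mat 1 \<and>
         U ** conj_transpose U = Finite_Cartesian_Product.mat 1}"

text \<open>The trace below is a nonnegative real number (\<open>of_real_frobenius_norm_sq\<close>), so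
  taking its real part loses nothing.\<close>

definition frobenius_norm :: "complex ^ 'n ^ 'n \<Rightarrow> real" where
  "frobenius_norm A = sqrt (Re (trace (conj_transpose A ** A)))"

text \<open>The norm on \<^typ>\<open>complex ^ 'n\<close> is the Euclidean one, so this is the operator norm
  with respect to it.\<close>

definition op_norm :: "complex ^ 'n ^ 'n \<Rightarrow> real" where
  "op_norm A = onorm (\<lambda>v. A *v v)"

lemma trace_conj_transpose_mult:
  fixes A :: "complex ^ 'n ^ 'n"
  shows "trace (conj_transpose A ** A) = of_real ((norm A)\<^sup>2)"
proof -
  have "trace (conj_transpose A ** A) = (\<Sum>j\<in>UNIV. \<Sum>i\<in>UNIV. cnj (A $ i $ j) * A $ i $ j)"
    by (simp add: trace_def matrix_matrix_mult_def conj_transpose_def)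
  also have "\<dots> = (\<Sum>i\<in>UNIV. \<Sum>j\<in>UNIV. of_real ((norm (A $ i $ j))\<^sup>2))"
    by (subst sum.swap) (simp only: complex_norm_square mult.commute)
  also have "\<dots> = of_real ((norm A)\<^sup>2)"
    by (simp add: norm_vec_def L2_set_def sum_nonneg)
  finally show ?thesis .
qed

lemma frobenius_norm_eq_norm: "frobenius_norm A = norm A"
  by (simp add: frobenius_norm_def trace_conj_transpose_mult)

lemma of_real_frobenius_norm_sq:
  "of_real ((frobenius_norm A)\<^sup>2) = trace (conj_transpose A ** A)"
  by (simp add: frobenius_norm_eq_norm trace_conj_transpose_mult)

text \<open>The dimension of a representation has to range over the natural numbers, so
  representations use matrices whose size is not part of the type.\<close>

abbreviation general_linear_group :: "nat \<Rightarrow> complex Matrix.mat monoid" where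
  "general_linear_group n \<equiv> units_of (ring_mat TYPE(complex) n ())"

definition is_representation ::
  "('g, 'b) monoid_scheme \<Rightarrow> nat \<Rightarrow> ('g \<Rightarrow> complex Matrix.mat) \<Rightarrow> bool" where
  "is_representation G n \<rho> \<longleftrightarrow> \<rho> \<in> hom G (general_linear_group n)"

definition is_irreducible_representation ::
  "('g, 'b) monoid_scheme \<Rightarrow> nat \<Rightarrow> ('g \<Rightarrow> complex Matrix.mat) \<Rightarrow> bool" where
  "is_irreducible_representation G n \<rho> \<longleftrightarrow>
     is_representation G n \<rho> \<and> 0 < n \<and>
     (\<forall>W. VectorSpace.subspace class_ring W (module_vec TYPE(complex) n) \<and>
           (\<forall>g\<in>carrier G. \<forall>w\<in>W. \<rho> g *\<^sub>v w \<in> W)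
        \<longrightarrow> W = {0\<^sub>v n} \<or> W = carrier_vec n)"

definition is_trivial_representation ::
  "('g, 'b) monoid_scheme \<Rightarrow> nat \<Rightarrow> ('g \<Rightarrow> complex Matrix.mat) \<Rightarrow> bool" where
  "is_trivial_representation G n \<rho> \<longleftrightarrow> n = 1 \<and> (\<forall>g\<in>carrier G. \<rho> g = 1\<^sub>m 1)"

text \<open>For a finite nontrivial group the set of such dimensions is nonempty, so the
  least element is genuinely attained.\<close>

definition min_nontrivial_irrep_dim :: "('g, 'b) monoid_scheme \<Rightarrow> nat" where
  "min_nontrivial_irrep_dim G =
     (LEAST n. \<exists>\<rho>. is_irreducible_representation G n \<rho> \<and> \<not> is_trivial_representation G n \<rho>)"

end

theory Submission
  imports Defs
begin

text \<open>
  Since \<open>\<psi>\<close> is unitary, the squared distance is \<open>2 d - 2 Re \<langle>\<psi>(xy), \<psi>(x) \<psi>(y)\<rangle>\<close>. Write \<open>\<psi> = P + \<phi>\<close>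
  with \<open>P\<close> the mean of \<open>\<psi>\<close>; on averaging the inner product, all mixed terms vanish. The term
  \<open>Re \<langle>P, P P\<rangle>\<close> is at most \<open>d\<close> times the cube of the operator norm of \<open>P\<close>, and the term in \<open>\<phi>\<close>
  alone is controlled by the mixing inequality of Babai, Nikolov and Pyber: convolution with a
  mean-zero \<open>f\<close> has squared operator norm \<open>\<lambda>\<close> at most \<open>|G|\<close> times the squared norm of \<open>f\<close>,
  divided by the least dimension of a nontrivial irreducible representation. The reason is that the
  functions on which convolution attains its norm form a subspace invariant under right translation
  and without nonzero constants; a minimal invariant subspace of it is a nontrivial irreducible
  representation, of dimension \<open>m\<close> say, and \<open>m \<lambda>\<close> is at most the squared Hilbert-Schmidt norm.
\<close>

subsection \<open>Orthonormal families of functions on a finite set\<close>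

text \<open>Linear in the first argument and conjugate-linear in the second. Values off
  \<open>C\<close> are invisible to it, so on total functions the form is only semidefinite.\<close>

definition cip :: "'a set \<Rightarrow> ('a \<Rightarrow> complex) \<Rightarrow> ('a \<Rightarrow> complex) \<Rightarrow> complex" where
  "cip C f g = (\<Sum>x\<in>C. f x * cnj (g x))"

definition sqn :: "'a set \<Rightarrow> ('a \<Rightarrow> complex) \<Rightarrow> real" where
  "sqn C f = (\<Sum>x\<in>C. (cmod (f x))\<^sup>2)"

lemma cip_self: "cip C f f = of_real (sqn C f)"
  unfolding cip_def sqn_def of_real_sum by (simp add: complex_norm_square[symmetric])

lemma sqn_nonneg [simp]: "0 \<le> sqn C f"
  by (simp add: sqn_def sum_nonneg)

lemma sqn_eq_0_iff: "finite C \<Longrightarrow> sqn C f = 0 \<longleftrightarrow> (\<forall>x\<in>C. f x = 0)"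
  by (simp add: sqn_def sum_nonneg_eq_0_iff)

lemma cip_cnj: "cnj (cip C f g) = cip C g f"
  by (simp add: cip_def mult.commute)

lemma cip_zero_left [simp]: "cip C (\<lambda>_. 0) g = 0"
  by (simp add: cip_def)

lemma cip_add_left: "cip C (\<lambda>x. f x + g x) h = cip C f h + cip C g h"
  by (simp add: cip_def distrib_right sum.distrib)

lemma cip_diff_left: "cip C (\<lambda>x. f x - g x) h = cip C f h - cip C g h"
  by (simp add: cip_def left_diff_distrib sum_subtractf)

lemma cip_scale_left: "cip C (\<lambda>x. a * f x) h = a * cip C f h"
  by (simp add: cip_def sum_distrib_left mult.assoc)

lemma cip_add_right: "cip C h (\<lambda>x. f x + g x) = cip C h f + cip C h g"
  by (simp add: cip_def distrib_left sum.distrib)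

lemma cip_sum_left: "cip C (\<lambda>x. \<Sum>i\<in>I. c i * e i x) h = (\<Sum>i\<in>I. c i * cip C (e i) h)"
  unfolding cip_def
  by (simp add: sum_distrib_left sum_distrib_right mult.assoc) (rule sum.swap)

lemma cip_sum_right: "cip C h (\<lambda>x. \<Sum>i\<in>I. c i * e i x) = (\<Sum>i\<in>I. cnj (c i) * cip C h (e i))"
proof -
  have "cip C h (\<lambda>x. \<Sum>i\<in>I. c i * e i x) = cnj (cip C (\<lambda>x. \<Sum>i\<in>I. c i * e i x) h)"
    by (simp add: cip_cnj)
  then show ?thesis by (simp add: cip_sum_left cip_cnj)
qed

lemma sqn_scale: "sqn C (\<lambda>x. a * f x) = (cmod a)\<^sup>2 * sqn C f"
  by (simp add: sqn_def norm_mult power_mult_distrib sum_distrib_left)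

text \<open>This identity later shows that the functions attaining an operator norm are closed under
  addition.\<close>

lemma sqn_parallelogram:
  "sqn C (\<lambda>x. f x + g x) + sqn C (\<lambda>x. f x - g x) = 2 * sqn C f + 2 * sqn C g"
proof -
  have "(cmod (a + b))\<^sup>2 + (cmod (a - b))\<^sup>2 = 2 * (cmod a)\<^sup>2 + 2 * (cmod b)\<^sup>2" for a b
    unfolding cmod_power2 by (simp add: power2_eq_square algebra_simps)
  then have "(\<Sum>x\<in>C. (cmod (f x + g x))\<^sup>2 + (cmod (f x - g x))\<^sup>2) =
      (\<Sum>x\<in>C. 2 * (cmod (f x))\<^sup>2 + 2 * (cmod (g x))\<^sup>2)"
    by (intro sum.cong) auto
  then show ?thesis
    by (simp only: sqn_def sum.distrib sum_distrib_left)
qed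

lemma sqn_pythagoras:
  assumes "cip C f g = 0"
  shows "sqn C (\<lambda>x. f x + g x) = sqn C f + sqn C g"
proof -
  have "cip C g f = 0"
    using assms cip_cnj[of C f g] by simp
  then have "cip C (\<lambda>x. f x + g x) (\<lambda>x. f x + g x) = cip C f f + cip C g g"
    using assms by (simp add: cip_add_left cip_add_right)
  then have "complex_of_real (sqn C (\<lambda>x. f x + g x)) = of_real (sqn C f + sqn C g)"
    by (simp add: cip_self)
  then show ?thesis
    by (simp only: of_real_eq_iff)
qed

text \<open>Minkowski's inequality, since \<open>sqrt (sqn C f)\<close> is the Euclidean norm of
  \<open>f\<close> restricted to \<open>C\<close>.\<close>

lemma L2_triangle_sum:
  assumes "finite I"
  shows "sqrt (sqn C (\<lambda>x. \<Sum>i\<in>I. f i x)) \<le> (\<Sum>i\<in>I. sqrt (sqn C (f i)))"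
  using assms
proof (induction I rule: finite_induct)
  case empty
  then show ?case by (simp add: sqn_def)
next
  case (insert j I)
  have "sqrt (sqn C (\<lambda>x. f j x + (\<Sum>i\<in>I. f i x))) =
      L2_set (\<lambda>x. cmod (f j x + (\<Sum>i\<in>I. f i x))) C"
    by (simp add: L2_set_def sqn_def)
  also have "\<dots> \<le> L2_set (\<lambda>x. cmod (f j x) + cmod (\<Sum>i\<in>I. f i x)) C"
    by (rule L2_set_mono) (auto simp: norm_triangle_ineq)
  also have "\<dots> \<le> L2_set (\<lambda>x. cmod (f j x)) C + L2_set (\<lambda>x. cmod (\<Sum>i\<in>I. f i x)) C"
    by (rule L2_set_triangle_ineq)
  also have "\<dots> = sqrt (sqn C (f j)) + sqrt (sqn C (\<lambda>x. \<Sum>i\<in>I. f i x))"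
    by (simp add: L2_set_def sqn_def)
  finally show ?case
    using insert by simp
qed

definition orthonormal :: "'a set \<Rightarrow> nat \<Rightarrow> (nat \<Rightarrow> 'a \<Rightarrow> complex) \<Rightarrow> bool" where
  "orthonormal C k e \<longleftrightarrow> (\<forall>i<k. \<forall>j<k. cip C (e i) (e j) = (if i = j then 1 else 0))"

text \<open>For an orthonormal family this is the orthogonal projection onto its span, so
  \<open>proj C k e w = w\<close> expresses that \<open>w\<close> lies in the span.\<close>

definition proj :: "'a set \<Rightarrow> nat \<Rightarrow> (nat \<Rightarrow> 'a \<Rightarrow> complex) \<Rightarrow> ('a \<Rightarrow> complex) \<Rightarrow> 'a \<Rightarrow> complex" where
  "proj C k e f = (\<lambda>x. \<Sum>i<k. cip C f (e i) * e i x)"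

lemma orthonormal_coeff:
  assumes "orthonormal C k e" "j < k"
  shows "cip C (\<lambda>x. \<Sum>i<k. c i * e i x) (e j) = c j"
proof -
  have "cip C (\<lambda>x. \<Sum>i<k. c i * e i x) (e j) = (\<Sum>i<k. if i = j then c i else 0)"
    unfolding cip_sum_left using assms by (intro sum.cong) (auto simp: orthonormal_def)
  then show ?thesis using assms by simp
qed

lemma proj_orthogonal:
  assumes "orthonormal C k e" "j < k"
  shows "cip C (\<lambda>x. f x - proj C k e f x) (e j) = 0"
  using orthonormal_coeff[OF assms, of "\<lambda>i. cip C f (e i)"]
  by (simp add: cip_diff_left proj_def)

lemma sqn_orthonormal_comb:
  assumes "orthonormal C k e"
  shows "sqn C (\<lambda>x. \<Sum>i<k. c i * e i x) = (\<Sum>i<k. (cmod (c i))\<^sup>2)"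
proof -
  let ?p = "\<lambda>x. \<Sum>i<k. c i * e i x"
  have "complex_of_real (sqn C ?p) = cip C ?p ?p"
    by (simp add: cip_self)
  also have "\<dots> = (\<Sum>i<k. cnj (c i) * cip C ?p (e i))"
    by (rule cip_sum_right)
  also have "\<dots> = (\<Sum>i<k. cnj (c i) * c i)"
    using assms by (intro sum.cong) (auto simp: orthonormal_coeff)
  also have "\<dots> = of_real (\<Sum>i<k. (cmod (c i))\<^sup>2)"
    by (simp add: complex_norm_square[symmetric] mult.commute)
  finally show ?thesis by (metis of_real_eq_iff)
qed

text \<open>Pythagoras applied to \<open>f\<close> as the sum of its projection and the remainder,
  which is orthogonal to every \<open>e i\<close>.\<close>

lemma bessel:
  assumes "orthonormal C k e"
  shows "(\<Sum>i<k. (cmod (cip C f (e i)))\<^sup>2) \<le> sqn C f"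
proof -
  let ?p = "proj C k e f"
  have "cip C (\<lambda>x. f x - ?p x) (\<lambda>x. \<Sum>i<k. cip C f (e i) * e i x) = 0"
    unfolding cip_sum_right using proj_orthogonal[OF assms] by simp
  then have "cip C (\<lambda>x. f x - ?p x) ?p = 0"
    by (simp add: proj_def)
  from sqn_pythagoras[OF this] have "sqn C f = sqn C (\<lambda>x. f x - ?p x) + sqn C ?p"
    by simp
  moreover have "sqn C ?p = (\<Sum>i<k. (cmod (cip C f (e i)))\<^sup>2)"
    unfolding proj_def by (rule sqn_orthonormal_comb[OF assms])
  ultimately show ?thesis by (smt (verit) sqn_nonneg)
qed

lemma orthonormal_sqn: "orthonormal C k e \<Longrightarrow> i < k \<Longrightarrow> sqn C (e i) = 1"
  using cip_self[of C "e i"] by (simp add: orthonormal_def)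

text \<open>Bessel for the point mass at \<open>z\<close> bounds the sum of
  \<open>(cmod (e i z))\<^sup>2\<close> over \<open>i\<close> by 1. Summing over \<open>z\<close> as
  well counts the members of the family, each having norm 1.\<close>

lemma orthonormal_le_card:
  assumes fin: "finite C" and on: "orthonormal C k e"
  shows "k \<le> card C"
proof -
  have "(\<Sum>i<k. (cmod (e i z))\<^sup>2) \<le> 1" if "z \<in> C" for z
  proof -
    let ?d = "\<lambda>x. if x = z then 1 else 0 :: complex"
    have "cip C ?d (e i) = cnj (e i z)" for i
      using fin that by (simp add: cip_def if_distrib[of "\<lambda>t. t * _"] cong: if_cong)
    moreover have "sqn C ?d = 1"
      using fin that by (simp add: sqn_def if_distrib[of cmod] if_distrib[of "\<lambda>t. t\<^sup>2"] cong: if_cong)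
    ultimately show ?thesis using bessel[OF on, of ?d] by simp
  qed
  then have "(\<Sum>z\<in>C. \<Sum>i<k. (cmod (e i z))\<^sup>2) \<le> (\<Sum>z\<in>C. 1)"
    by (rule sum_mono)
  moreover have "(\<Sum>z\<in>C. \<Sum>i<k. (cmod (e i z))\<^sup>2) = (\<Sum>i<k. sqn C (e i))"
    unfolding sqn_def by (rule sum.swap)
  ultimately show ?thesis using orthonormal_sqn[OF on] by simp
qed

text \<open>Functions on \<open>C\<close> are total functions vanishing off \<open>C\<close>, so that equality of functions is
  equality on \<open>C\<close>.\<close>

definition fun_subspace :: "'a set \<Rightarrow> ('a \<Rightarrow> complex) set \<Rightarrow> bool" where
  "fun_subspace C W \<longleftrightarrow> (\<forall>f\<in>W. \<forall>x. x \<notin> C \<longrightarrow> f x = 0) \<and> (\<lambda>_. 0) \<in> W \<and>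
     (\<forall>f\<in>W. \<forall>g\<in>W. (\<lambda>x. f x + g x) \<in> W) \<and> (\<forall>a. \<forall>f\<in>W. (\<lambda>x. a * f x) \<in> W)"

lemma fun_subspace_support: "fun_subspace C W \<Longrightarrow> f \<in> W \<Longrightarrow> x \<notin> C \<Longrightarrow> f x = 0"
  by (simp add: fun_subspace_def)

lemma fun_subspace_zero: "fun_subspace C W \<Longrightarrow> (\<lambda>_. 0) \<in> W"
  by (simp add: fun_subspace_def)

lemma fun_subspace_add: "fun_subspace C W \<Longrightarrow> f \<in> W \<Longrightarrow> g \<in> W \<Longrightarrow> (\<lambda>x. f x + g x) \<in> W"
  by (simp add: fun_subspace_def)

lemma fun_subspace_scale: "fun_subspace C W \<Longrightarrow> f \<in> W \<Longrightarrow> (\<lambda>x. a * f x) \<in> W"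
  by (simp add: fun_subspace_def)

lemma fun_subspace_sum:
  assumes "fun_subspace C W" "\<And>i. i \<in> I \<Longrightarrow> e i \<in> W" "finite I"
  shows "(\<lambda>x. \<Sum>i\<in>I. c i * e i x) \<in> W"
  using assms(3,2)
proof (induction I rule: finite_induct)
  case empty
  then show ?case using assms(1) by (simp add: fun_subspace_def)
next
  case (insert j I)
  have "(\<lambda>x. c j * e j x + (\<Sum>i\<in>I. c i * e i x)) \<in> W"
    using insert by (intro fun_subspace_add[OF assms(1)] fun_subspace_scale[OF assms(1)]) auto
  then show ?case using insert(1,2) by simp
qed

lemma fun_subspace_diff:
  assumes "fun_subspace C W" "f \<in> W" "g \<in> W"
  shows "(\<lambda>x. f x - g x) \<in> W"
proof -
  have "(\<lambda>x. f x + (-1) * g x) \<in> W"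
    by (rule fun_subspace_add[OF assms(1,2) fun_subspace_scale[OF assms(1,3)]])
  then show ?thesis by simp
qed

lemma proj_in_subspace:
  assumes "fun_subspace C W" "\<And>i. i < k \<Longrightarrow> e i \<in> W"
  shows "proj C k e f \<in> W"
  unfolding proj_def using assms by (intro fun_subspace_sum) auto

text \<open>One Gram-Schmidt step: the remainder of \<open>w\<close> after projection is nonzero and
  orthogonal to the family, so it can be normalised and appended.\<close>

lemma orthonormal_extend:
  assumes fin: "finite C" and W: "fun_subspace C W" and on: "orthonormal C k e"
    and e: "\<And>i. i < k \<Longrightarrow> e i \<in> W" and w: "w \<in> W" "w \<noteq> proj C k e w"
  shows "\<exists>e'. orthonormal C (Suc k) e' \<and> (\<forall>i<Suc k. e' i \<in> W)"
proof -
  define r where "r = (\<lambda>x. w x - proj C k e w x)"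
  have rW: "r \<in> W"
    unfolding r_def using fun_subspace_diff[OF W w(1) proj_in_subspace[OF W e]] by simp
  have "r \<noteq> (\<lambda>_. 0)"
    using w(2) by (auto simp: r_def fun_eq_iff)
  then obtain x where "r x \<noteq> 0"
    by blast
  \<comment> \<open>Members of \<open>W\<close> vanish off \<open>C\<close>, so the point where
    \<open>r\<close> is nonzero lies in \<open>C\<close>, where \<open>sqn\<close> sees it.\<close>
  then have "sqn C r \<noteq> 0"
    using sqn_eq_0_iff[OF fin, of r] fun_subspace_support[OF W rW, of x] by blast
  then have pos: "sqn C r > 0"
    by (smt (verit) sqn_nonneg)
  define a where "a = complex_of_real (1 / sqrt (sqn C r))"
  define v where "v = (\<lambda>x. a * r x)"
  have "v \<in> W"
    unfolding v_def by (rule fun_subspace_scale[OF W rW])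
  moreover have vv: "cip C v v = 1"
  proof -
    have "(cmod a)\<^sup>2 = 1 / sqn C r"
      using pos by (simp add: a_def norm_divide power_divide)
    then show ?thesis
      using pos unfolding v_def cip_self sqn_scale by simp
  qed
  moreover have ve: "cip C v (e j) = 0" if "j < k" for j
    using proj_orthogonal[OF on that, of w] by (simp add: v_def r_def cip_scale_left)
  moreover have "cip C (e j) v = 0" if "j < k" for j
    using ve[OF that] cip_cnj[of C v "e j"] by simp
  ultimately have "orthonormal C (Suc k) (e(k := v)) \<and> (\<forall>i<Suc k. (e(k := v)) i \<in> W)"
    using on e by (auto simp: orthonormal_def less_Suc_eq)
  then show ?thesis by blast
qed

text \<open>The dimension, measured as the largest size of an orthonormal family; such families have at
  most \<open>card C\<close> members when \<open>C\<close> is finite, so \<open>GREATEST\<close> is meaningful.\<close>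

definition fun_dim :: "'a set \<Rightarrow> ('a \<Rightarrow> complex) set \<Rightarrow> nat" where
  "fun_dim C W = (GREATEST k. \<exists>e. orthonormal C k e \<and> (\<forall>i<k. e i \<in> W))"

lemma fun_dim_greatest:
  assumes "finite C"
  shows "\<exists>e. orthonormal C (fun_dim C W) e \<and> (\<forall>i<fun_dim C W. e i \<in> W)"
  unfolding fun_dim_def
proof (rule GreatestI_nat[where k = 0 and b = "card C"])
  show "\<exists>e. orthonormal C 0 e \<and> (\<forall>i<0. e i \<in> W)"
    by (simp add: orthonormal_def)
qed (use orthonormal_le_card[OF assms] in blast)

lemma orthonormal_le_fun_dim:
  assumes "finite C" "orthonormal C k e" "\<And>i. i < k \<Longrightarrow> e i \<in> W"
  shows "k \<le> fun_dim C W"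
  unfolding fun_dim_def
proof (rule Greatest_le_nat[where b = "card C"])
  show "\<exists>e. orthonormal C k e \<and> (\<forall>i<k. e i \<in> W)"
    using assms(2,3) by blast
qed (use orthonormal_le_card[OF assms(1)] in blast)

text \<open>An orthonormal family of the greatest size in \<open>W\<close> spans \<open>W\<close>:
  an element outside its span would allow a Gram-Schmidt step to a larger family.\<close>

lemma orthonormal_basis_exists:
  assumes "finite C" "fun_subspace C W"
  obtains e where "orthonormal C (fun_dim C W) e" "\<And>i. i < fun_dim C W \<Longrightarrow> e i \<in> W"
    "\<And>w. w \<in> W \<Longrightarrow> proj C (fun_dim C W) e w = w"
proof -
  obtain e where e: "orthonormal C (fun_dim C W) e" "\<And>i. i < fun_dim C W \<Longrightarrow> e i \<in> W"
    using fun_dim_greatest[OF assms(1)] by blast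
  have "proj C (fun_dim C W) e w = w" if "w \<in> W" for w
  proof (rule ccontr)
    assume "proj C (fun_dim C W) e w \<noteq> w"
    then have "w \<noteq> proj C (fun_dim C W) e w"
      by (rule not_sym)
    from orthonormal_extend[OF assms e that this]
    obtain e' where "orthonormal C (Suc (fun_dim C W)) e'" "\<forall>i<Suc (fun_dim C W). e' i \<in> W"
      by blast
    then have "Suc (fun_dim C W) \<le> fun_dim C W"
      using orthonormal_le_fun_dim[OF assms(1)] by blast
    then show False by simp
  qed
  with e show thesis by (rule that)
qed

text \<open>An element of \<open>W\<close> outside \<open>U\<close> is not in the span of a largest
  family of \<open>U\<close>, so that family grows by one inside \<open>W\<close>.\<close>

lemma fun_dim_strict_mono:
  assumes "finite C" "fun_subspace C U" "fun_subspace C W" "U \<subset> W"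
  shows "fun_dim C U < fun_dim C W"
proof -
  obtain e where e: "orthonormal C (fun_dim C U) e" "\<And>i. i < fun_dim C U \<Longrightarrow> e i \<in> U"
    using fun_dim_greatest[OF assms(1)] by blast
  obtain w where w: "w \<in> W" "w \<notin> U"
    using assms(4) by blast
  have "w \<noteq> proj C (fun_dim C U) e w"
  proof
    assume "w = proj C (fun_dim C U) e w"
    moreover have "proj C (fun_dim C U) e w \<in> U"
      using assms(2) e(2) by (rule proj_in_subspace)
    ultimately show False using w(2) by simp
  qed
  moreover have "\<And>i. i < fun_dim C U \<Longrightarrow> e i \<in> W"
    using e(2) assms(4) by blast
  ultimately obtain e' where "orthonormal C (Suc (fun_dim C U)) e'"
      "\<forall>i<Suc (fun_dim C U). e' i \<in> W"
    using orthonormal_extend[OF assms(1,3) e(1) _ w(1)] by blast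
  then have "Suc (fun_dim C U) \<le> fun_dim C W"
    using orthonormal_le_fun_dim[OF assms(1)] by blast
  then show ?thesis by simp
qed

subsection \<open>Irreducible representations from minimal invariant subspaces\<close>

locale finite_group = group G for G (structure) +
  assumes finite_carrier: "finite (carrier G)"
begin

text \<open>Multiplying on the right makes translation by \<open>a\<close> after translation by
  \<open>b\<close> the translation by \<open>a \<otimes> b\<close>, in this order. The cut-off keeps
  the result supported on the group.\<close>

definition right_translate :: "'a \<Rightarrow> ('a \<Rightarrow> complex) \<Rightarrow> 'a \<Rightarrow> complex" where
  "right_translate a f = (\<lambda>z. if z \<in> carrier G then f (z \<otimes> a) else 0)"

lemma right_translate_sum:
  "right_translate a (\<lambda>x. \<Sum>i\<in>I. c i * e i x) = (\<lambda>x. \<Sum>i\<in>I. c i * right_translate a (e i) x)"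
  by (auto simp: right_translate_def)

lemma right_translate_mult:
  "a \<in> carrier G \<Longrightarrow> b \<in> carrier G \<Longrightarrow>
    right_translate a (right_translate b f) = right_translate (a \<otimes> b) f"
  by (auto simp: right_translate_def m_assoc)

lemma right_translate_one:
  "(\<And>x. x \<notin> carrier G \<Longrightarrow> f x = 0) \<Longrightarrow> right_translate \<one> f = f"
  by (auto simp: right_translate_def)

lemma sum_right_translate:
  assumes "a \<in> carrier G"
  shows "(\<Sum>x\<in>carrier G. h (x \<otimes> a)) = (\<Sum>x\<in>carrier G. h x)"
  by (rule sum.reindex_bij_witness[of _ "\<lambda>x. x \<otimes> inv a" "\<lambda>x. x \<otimes> a"])
    (use assms in \<open>auto simp: m_assoc\<close>)

lemma sum_left_translate:
  assumes "a \<in> carrier G"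
  shows "(\<Sum>x\<in>carrier G. h (a \<otimes> x)) = (\<Sum>x\<in>carrier G. h x)"
  by (rule sum.reindex_bij_witness[of _ "\<lambda>x. inv a \<otimes> x" "\<lambda>x. a \<otimes> x"])
    (use assms in \<open>auto simp: m_assoc[symmetric]\<close>)

lemma sum_inverse: "(\<Sum>x\<in>carrier G. h (inv x)) = (\<Sum>x\<in>carrier G. h x)"
  by (rule sum.reindex_bij_witness[of _ "\<lambda>x. inv x" "\<lambda>x. inv x"]) auto

lemma sqn_right_translate:
  assumes "a \<in> carrier G"
  shows "sqn (carrier G) (right_translate a f) = sqn (carrier G) f"
proof -
  have "sqn (carrier G) (right_translate a f) = (\<Sum>x\<in>carrier G. (cmod (f (x \<otimes> a)))\<^sup>2)"
    unfolding sqn_def by (intro sum.cong) (auto simp: right_translate_def)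
  then show ?thesis
    using sum_right_translate[OF assms, of "\<lambda>x. (cmod (f x))\<^sup>2"] by (simp add: sqn_def)
qed

definition invariant_subspace :: "('a \<Rightarrow> complex) set \<Rightarrow> bool" where
  "invariant_subspace W \<longleftrightarrow> fun_subspace (carrier G) W \<and>
     (\<forall>a\<in>carrier G. \<forall>f\<in>W. right_translate a f \<in> W)"

text \<open>When \<open>e\<close> is an orthonormal basis of an invariant subspace, this is the
  matrix of right translation in that basis; column \<open>j\<close> holds the coordinates of the
  translate of \<open>e j\<close>.\<close>

definition rep_matrix :: "nat \<Rightarrow> (nat \<Rightarrow> 'a \<Rightarrow> complex) \<Rightarrow> 'a \<Rightarrow> complex Matrix.mat" where
  "rep_matrix m e a =
     Matrix.mat m m (\<lambda>(i, j). cip (carrier G) (right_translate a (e j)) (e i))"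

lemma rep_matrix_carrier [simp]: "rep_matrix m e a \<in> carrier_mat m m"
  by (simp add: rep_matrix_def)

text \<open>Among the nonzero invariant subspaces of \<open>V\<close>, one of least dimension is
  minimal for inclusion, because dimension is strictly monotone.\<close>

lemma minimal_invariant_subspace_exists:
  assumes "invariant_subspace V" "V \<noteq> {\<lambda>_. 0}"
  obtains W where "invariant_subspace W" "W \<noteq> {\<lambda>_. 0}" "W \<subseteq> V"
    "\<And>U. invariant_subspace U \<Longrightarrow> U \<subseteq> W \<Longrightarrow> U = {\<lambda>_. 0} \<or> U = W"
proof -
  let ?P = "\<lambda>W. invariant_subspace W \<and> W \<noteq> {\<lambda>_. 0} \<and> W \<subseteq> V"
  obtain W where W: "?P W"
    and least: "\<And>U. ?P U \<Longrightarrow> fun_dim (carrier G) W \<le> fun_dim (carrier G) U"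
    using ex_has_least_nat[of ?P V "fun_dim (carrier G)"] assms by auto
  have "U = {\<lambda>_. 0} \<or> U = W" if "invariant_subspace U" "U \<subseteq> W" for U
  proof (rule ccontr)
    assume U: "\<not> ?thesis"
    then have "?P U"
      using that W by blast
    then have "fun_dim (carrier G) W \<le> fun_dim (carrier G) U"
      by (rule least)
    moreover have "fun_dim (carrier G) U < fun_dim (carrier G) W"
      using U that W finite_carrier
      by (intro fun_dim_strict_mono) (auto simp: invariant_subspace_def)
    ultimately show False by simp
  qed
  with W show thesis using that by blast
qed

text \<open>The representation is right translation on \<open>W\<close>, written in an orthonormal
  basis. Coordinates identify its invariant subspaces with those of \<open>W\<close>, so minimality
  becomes irreducibility. The second conclusion lets a caller rule out triviality by excluding
  nonzero translation-invariant functions.\<close>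

lemma minimal_subspace_irreducible_rep:
  assumes W: "invariant_subspace W" "W \<noteq> {\<lambda>_. 0}"
    and minimal: "\<And>U. invariant_subspace U \<Longrightarrow> U \<subseteq> W \<Longrightarrow> U = {\<lambda>_. 0} \<or> U = W"
  obtains \<rho> where "is_irreducible_representation G (fun_dim (carrier G) W) \<rho>"
    "is_trivial_representation G (fun_dim (carrier G) W) \<rho> \<longrightarrow>
       (\<exists>w\<in>W. w \<noteq> (\<lambda>_. 0) \<and> (\<forall>a\<in>carrier G. right_translate a w = w))"
proof -
  let ?C = "carrier G"
  let ?R = right_translate
  define m where "m = fun_dim ?C W"
  have sub: "fun_subspace ?C W" and R: "\<And>a f. a \<in> ?C \<Longrightarrow> f \<in> W \<Longrightarrow> ?R a f \<in> W"
    using W by (auto simp: invariant_subspace_def)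
  obtain e where on: "orthonormal ?C m e" and eW: "\<And>i. i < m \<Longrightarrow> e i \<in> W"
    and proj: "\<And>w. w \<in> W \<Longrightarrow> proj ?C m e w = w"
    using orthonormal_basis_exists[OF finite_carrier sub] unfolding m_def by blast
  define \<rho> where "\<rho> = rep_matrix m e"
  \<comment> \<open>The coordinate map from column vectors to functions in \<open>W\<close>.\<close>
  define emb where "emb u = (\<lambda>x. \<Sum>j<m. Matrix.vec_index u j * e j x)" for u
  have expand: "?R a (e j) = (\<lambda>x. \<Sum>i<m. cip ?C (?R a (e j)) (e i) * e i x)"
    if "a \<in> ?C" "j < m" for a j
    using proj[OF R[OF that(1) eW[OF that(2)]]] by (simp add: proj_def)
  have m_pos: "0 < m"
  proof (rule ccontr)
    assume "\<not> 0 < m"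
    then have "w = (\<lambda>_. 0)" if "w \<in> W" for w
      using proj[OF that] by (simp add: proj_def)
    then show False
      using W(2) fun_subspace_zero[OF sub] by blast
  qed
  \<comment> \<open>Expand the translate of \<open>e k\<close> by \<open>b\<close> in the basis,
    then translate by \<open>a\<close> term by term.\<close>
  have mult: "\<rho> a * \<rho> b = \<rho> (a \<otimes> b)" if ab: "a \<in> ?C" "b \<in> ?C" for a b
  proof (rule eq_matI)
    fix i k assume "i < dim_row (\<rho> (a \<otimes> b))" "k < dim_col (\<rho> (a \<otimes> b))"
    then have ik: "i < m" "k < m"
      by (simp_all add: \<rho>_def rep_matrix_def)
    have "(\<rho> a * \<rho> b) $$ (i, k) =
        (\<Sum>j<m. cip ?C (?R b (e k)) (e j) * cip ?C (?R a (e j)) (e i))"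
      using ik by (simp add: \<rho>_def rep_matrix_def scalar_prod_def atLeast0LessThan mult.commute)
    also have "\<dots> = cip ?C (?R a (\<lambda>x. \<Sum>j<m. cip ?C (?R b (e k)) (e j) * e j x)) (e i)"
      by (simp add: right_translate_sum cip_sum_left)
    also have "\<dots> = cip ?C (?R a (?R b (e k))) (e i)"
      using expand[OF ab(2) ik(2)] by simp
    also have "\<dots> = \<rho> (a \<otimes> b) $$ (i, k)"
      using ik ab by (simp add: right_translate_mult \<rho>_def rep_matrix_def)
    finally show "(\<rho> a * \<rho> b) $$ (i, k) = \<rho> (a \<otimes> b) $$ (i, k)" .
  qed (simp_all add: \<rho>_def rep_matrix_def)
  have one: "\<rho> \<one> = 1\<^sub>m m"
  proof (rule eq_matI)
    fix i j assume "i < dim_row (1\<^sub>m m :: complex Matrix.mat)" "j < dim_col (1\<^sub>m m :: complex Matrix.mat)"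
    then have ij: "i < m" "j < m" by simp_all
    have "?R \<one> (e j) = e j"
      using fun_subspace_support[OF sub eW[OF ij(2)]] by (rule right_translate_one)
    then show "\<rho> \<one> $$ (i, j) = 1\<^sub>m m $$ (i, j)"
      using ij on by (simp add: \<rho>_def rep_matrix_def orthonormal_def)
  qed (simp_all add: \<rho>_def rep_matrix_def)
  have "\<rho> a \<in> Units (ring_mat TYPE(complex) m ())" if "a \<in> ?C" for a
  proof -
    have "\<rho> a * \<rho> (inv a) = 1\<^sub>m m" "\<rho> (inv a) * \<rho> a = 1\<^sub>m m"
      using that by (simp_all add: mult one)
    then show ?thesis
      unfolding Units_def ring_mat_def by (auto simp: \<rho>_def intro!: bexI[of _ "rep_matrix m e (inv a)"])
  qed
  then have rep: "is_representation G m \<rho>"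
    unfolding is_representation_def hom_def
    by (auto simp: units_of_carrier units_of_mult ring_mat_def mult)
  \<comment> \<open>The coordinate map intertwines the matrices with right translation.\<close>
  have emb_R: "emb (\<rho> a *\<^sub>v u) = ?R a (emb u)" if a: "a \<in> ?C" and u: "u \<in> carrier_vec m" for a u
  proof -
    have "emb (\<rho> a *\<^sub>v u) =
        (\<lambda>x. \<Sum>i<m. \<Sum>j<m. cip ?C (?R a (e j)) (e i) * Matrix.vec_index u j * e i x)"
      using u by (auto simp: emb_def \<rho>_def rep_matrix_def scalar_prod_def atLeast0LessThan
        sum_distrib_right intro!: ext sum.cong)
    also have "\<dots> = (\<lambda>x. \<Sum>j<m. Matrix.vec_index u j * (\<Sum>i<m. cip ?C (?R a (e j)) (e i) * e i x))"
      by (intro ext, subst sum.swap) (simp add: sum_distrib_left mult_ac)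
    also have "\<dots> = (\<lambda>x. \<Sum>j<m. Matrix.vec_index u j * ?R a (e j) x)"
    proof (intro ext sum.cong refl)
      fix x j assume "j \<in> {..<m}"
      then show "Matrix.vec_index u j * (\<Sum>i<m. cip ?C (?R a (e j)) (e i) * e i x) =
          Matrix.vec_index u j * ?R a (e j) x"
        using fun_cong[OF expand[OF a, of j], of x] by simp
    qed
    also have "\<dots> = ?R a (emb u)"
      by (simp add: emb_def right_translate_sum)
    finally show ?thesis .
  qed
  \<comment> \<open>Coordinates can be read off by inner products, so \<open>emb\<close> is
    injective on vectors of dimension \<open>m\<close>.\<close>
  have emb_coeff: "cip ?C (emb u) (e j) = Matrix.vec_index u j" if "j < m" for u j
    unfolding emb_def by (rule orthonormal_coeff[OF on that])
  have emb_W: "emb u \<in> W" for u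
    unfolding emb_def using sub eW by (intro fun_subspace_sum) auto
  have "U = {0\<^sub>v m} \<or> U = carrier_vec m"
    if U: "VectorSpace.subspace class_ring U (module_vec TYPE(complex) m)"
      and inv: "\<forall>a\<in>?C. \<forall>u\<in>U. \<rho> a *\<^sub>v u \<in> U" for U
  proof -
    have sm: "submodule class_ring U (module_vec TYPE(complex) m)"
      using U by (simp add: VectorSpace.subspace_def)
    have U_carrier: "U \<subseteq> carrier_vec m"
      using submodule.subset[OF sm] by (simp add: module_vec_simps)
    have U_zero: "0\<^sub>v m \<in> U"
      using submodule.zero_closed[OF sm] by (simp add: module_vec_simps)
    have U_add: "u + v \<in> U" if "u \<in> U" "v \<in> U" for u v
      using submodule.m_closed[OF sm that] by (simp add: module_vec_simps)
    have U_smult: "c \<cdot>\<^sub>v u \<in> U" if "u \<in> U" for c u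
      using submodule.smult_closed[OF sm _ that, of c] by (simp add: module_vec_simps class_ring_simps)
    have emb_zero: "emb (0\<^sub>v m) = (\<lambda>_. 0)"
      by (simp add: emb_def)
    have emb_add: "emb (u + v) = (\<lambda>x. emb u x + emb v x)"
      if "u \<in> carrier_vec m" "v \<in> carrier_vec m" for u v
      using that by (simp add: emb_def distrib_right sum.distrib)
    have emb_smult: "emb (c \<cdot>\<^sub>v u) = (\<lambda>x. c * emb u x)" if "u \<in> carrier_vec m" for c u
      using that by (simp add: emb_def sum_distrib_left mult.assoc)
    \<comment> \<open>The invariant subspace \<open>U\<close> is moved into \<open>W\<close>, where
      minimality of \<open>W\<close> applies to its image.\<close>
    have "fun_subspace ?C (emb ` U)"
      unfolding fun_subspace_def
    proof (intro conjI ballI allI impI)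
      fix f x assume "f \<in> emb ` U" "x \<notin> ?C"
      then show "f x = 0" using fun_subspace_support[OF sub] emb_W by blast
    next
      show "(\<lambda>_. 0) \<in> emb ` U"
        using U_zero emb_zero by (metis imageI)
    next
      fix f g assume "f \<in> emb ` U" "g \<in> emb ` U"
      then obtain u v where uv: "u \<in> U" "v \<in> U" "f = emb u" "g = emb v" by blast
      then have "(\<lambda>x. f x + g x) = emb (u + v)"
        using U_carrier by (subst emb_add) auto
      then show "(\<lambda>x. f x + g x) \<in> emb ` U"
        using U_add[OF uv(1,2)] by simp
    next
      fix c f assume "f \<in> emb ` U"
      then obtain u where u: "u \<in> U" "f = emb u" by blast
      then have "(\<lambda>x. c * f x) = emb (c \<cdot>\<^sub>v u)"
        using U_carrier by (subst emb_smult) auto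
      then show "(\<lambda>x. c * f x) \<in> emb ` U"
        using U_smult[OF u(1)] by simp
    qed
    moreover have "?R a f \<in> emb ` U" if a: "a \<in> ?C" and f: "f \<in> emb ` U" for a f
    proof -
      obtain u where u: "u \<in> U" "f = emb u" using f by blast
      then have "?R a f = emb (\<rho> a *\<^sub>v u)"
        using emb_R[OF a] U_carrier by auto
      then show ?thesis using inv a u(1) by simp
    qed
    ultimately have "invariant_subspace (emb ` U)"
      by (simp add: invariant_subspace_def)
    moreover have "emb ` U \<subseteq> W"
      using emb_W by blast
    ultimately have "emb ` U = {\<lambda>_. 0} \<or> emb ` U = W"
      by (rule minimal)
    then show ?thesis
    proof
      assume zero: "emb ` U = {\<lambda>_. 0}"
      have "u = 0\<^sub>v m" if "u \<in> U" for u
      proof (rule eq_vecI)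
        show "dim_vec u = dim_vec (0\<^sub>v m)"
          using that U_carrier by auto
        fix j assume "j < dim_vec (0\<^sub>v m :: complex Matrix.vec)"
        then have "j < m" by simp
        moreover have "emb u = (\<lambda>_. 0)"
          using zero that by blast
        ultimately show "Matrix.vec_index u j = Matrix.vec_index (0\<^sub>v m) j"
          using emb_coeff[of j u] by simp
      qed
      then show ?thesis using U_zero by blast
    next
      assume full: "emb ` U = W"
      have "v \<in> U" if v: "v \<in> carrier_vec m" for v
      proof -
        obtain u where u: "u \<in> U" "emb v = emb u"
          using full emb_W[of v] by blast
        have "v = u"
        proof (rule eq_vecI)
          show "dim_vec v = dim_vec u" using u v U_carrier by auto
          fix j assume "j < dim_vec u"
          then have "j < m" using u U_carrier by auto
          then show "Matrix.vec_index v j = Matrix.vec_index u j"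
            using emb_coeff[of j u] emb_coeff[of j v] u(2) by simp
        qed
        then show ?thesis using u by simp
      qed
      then show ?thesis using U_carrier by blast
    qed
  qed
  then have irr: "is_irreducible_representation G m \<rho>"
    unfolding is_irreducible_representation_def using rep m_pos by blast
  \<comment> \<open>In dimension one \<open>e 0\<close> spans \<open>W\<close>, and the single
    matrix entry 1 says that translation fixes it.\<close>
  have triv: "\<exists>w\<in>W. w \<noteq> (\<lambda>_. 0) \<and> (\<forall>a\<in>?C. ?R a w = w)"
    if t: "is_trivial_representation G m \<rho>"
  proof -
    have m1: "m = 1" and r1: "\<And>a. a \<in> ?C \<Longrightarrow> \<rho> a = 1\<^sub>m 1"
      using t by (auto simp: is_trivial_representation_def)
    have "?R a (e 0) = e 0" if "a \<in> ?C" for a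
    proof -
      have "cip ?C (?R a (e 0)) (e 0) = \<rho> a $$ (0, 0)"
        using m1 by (simp add: \<rho>_def rep_matrix_def)
      also have "\<dots> = 1"
        using r1[OF that] by simp
      finally show ?thesis
        using expand[OF that, of 0] m1 by simp
    qed
    moreover have "e 0 \<noteq> (\<lambda>_. 0)"
      using orthonormal_sqn[OF on m_pos] by (auto simp: sqn_def)
    ultimately show ?thesis
      using eW[OF m_pos] by blast
  qed
  show thesis
    using that[of \<rho>] irr triv unfolding m_def by blast
qed

end

subsection \<open>The mixing inequality\<close>

text \<open>The unit sphere of functions supported on \<open>C\<close> is compact in the product
  topology, so a continuous \<open>h\<close> attains its maximum there.\<close>

lemma sqn_maximizer_exists:
  fixes h :: "('a \<Rightarrow> complex) \<Rightarrow> real"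
  assumes fin: "finite C" and ne: "C \<noteq> {}" and cont: "continuous_on UNIV h"
  obtains g where "\<And>x. x \<notin> C \<Longrightarrow> g x = 0" "sqn C g = 1"
    "\<And>f. (\<And>x. x \<notin> C \<Longrightarrow> f x = 0) \<Longrightarrow> sqn C f = 1 \<Longrightarrow> h f \<le> h g"
proof -
  \<comment> \<open>Off \<open>C\<close> the factors are the singleton \<open>{0}\<close>. Hence
    Tychonoff gives compactness even if the type \<open>'a\<close> is infinite.\<close>
  define B where "B = Pi\<^sub>E UNIV (\<lambda>x. if x \<in> C then cball 0 1 else {0 :: complex})"
  define K where "K = B \<inter> {g. sqn C g = 1}"
  have "compactin (product_topology (\<lambda>_. euclidean) UNIV) B"
    unfolding B_def compactin_PiE by (simp add: compactin_euclidean_iff)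
  then have "compact B"
    by (simp add: euclidean_product_topology compactin_euclidean_iff)
  moreover have "closed {g :: 'a \<Rightarrow> complex. sqn C g = 1}"
    unfolding sqn_def by (intro closed_Collect_eq continuous_intros) simp_all
  ultimately have "compact K"
    unfolding K_def by (rule compact_Int_closed)
  have K_iff: "g \<in> K \<longleftrightarrow> (\<forall>x. x \<notin> C \<longrightarrow> g x = 0) \<and> sqn C g = 1" for g
  proof -
    \<comment> \<open>A unit function is bounded by 1 at each point, so intersecting with
      \<open>B\<close> loses no unit function supported on \<open>C\<close>.\<close>
    have "cmod (g x) \<le> 1" if "sqn C g = 1" "x \<in> C" for x
    proof -
      have "(cmod (g x))\<^sup>2 \<le> sqn C g"
        unfolding sqn_def using fin that(2) by (intro member_le_sum) auto
      then show ?thesis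
        using that(1) by (simp add: power_le_one_iff abs_square_le_1)
    qed
    then show ?thesis
      by (auto simp: K_def B_def PiE_iff split: if_splits)
  qed
  obtain c where c: "c \<in> C"
    using ne by blast
  \<comment> \<open>A point mass shows that the sphere is nonempty.\<close>
  have "(\<lambda>x. if x = c then 1 else 0) \<in> K"
    unfolding K_iff using c fin
    by (auto simp: sqn_def if_distrib[of cmod] if_distrib[of "\<lambda>t. t\<^sup>2"] cong: if_cong)
  then have "K \<noteq> {}"
    by blast
  then obtain g where "g \<in> K" "\<forall>f\<in>K. h f \<le> h g"
    using continuous_attains_sup[OF \<open>compact K\<close> _ continuous_on_subset[OF cont]] by blast
  then show thesis
    by (intro that[of g]) (simp_all add: K_iff)
qed

section \<open>Convolution operators on the group\<close>

context finite_group
begin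

definition convolution :: "('a \<Rightarrow> complex) \<Rightarrow> ('a \<Rightarrow> complex) \<Rightarrow> 'a \<Rightarrow> complex" where
  "convolution f g =
     (\<lambda>z. if z \<in> carrier G then \<Sum>x\<in>carrier G. f x * g (inv x \<otimes> z) else 0)"

lemma convolution_add:
  "convolution f (\<lambda>x. g x + h x) = (\<lambda>z. convolution f g z + convolution f h z)"
  by (auto simp: convolution_def distrib_left sum.distrib)

lemma convolution_diff:
  "convolution f (\<lambda>x. g x - h x) = (\<lambda>z. convolution f g z - convolution f h z)"
  by (auto simp: convolution_def right_diff_distrib sum_subtractf)

lemma convolution_scale: "convolution f (\<lambda>x. a * g x) = (\<lambda>z. a * convolution f g z)"
  by (auto simp: convolution_def sum_distrib_left mult_ac)

text \<open>Convolution by \<open>f\<close> combines left translates of \<open>g\<close>, and left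
  translations commute with right ones. This makes the space of norm-attaining functions
  invariant.\<close>

lemma convolution_right_translate:
  "a \<in> carrier G \<Longrightarrow> convolution f (right_translate a g) = right_translate a (convolution f g)"
  by (auto simp: convolution_def right_translate_def m_assoc intro!: ext sum.cong)

lemma convolution_cong:
  "(\<And>x. x \<in> carrier G \<Longrightarrow> g x = h x) \<Longrightarrow> convolution f g = convolution f h"
  by (auto simp: convolution_def intro!: ext sum.cong)

text \<open>The substitution \<open>w = inv x \<otimes> z\<close> exhibits convolution as an
  operator with kernel \<open>f (z \<otimes> inv w)\<close>, to whose rows Bessel applies.\<close>

lemma convolution_eq_cip:
  assumes "z \<in> carrier G"
  shows "convolution f g z = cip (carrier G) g (\<lambda>w. cnj (f (z \<otimes> inv w)))"
proof -
  have "(\<Sum>x\<in>carrier G. f x * g (inv x \<otimes> z)) = (\<Sum>w\<in>carrier G. g w * f (z \<otimes> inv w))"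
    by (rule sum.reindex_bij_witness[of _ "\<lambda>w. z \<otimes> inv w" "\<lambda>x. inv x \<otimes> z"])
      (use assms in \<open>auto simp: m_assoc[symmetric] inv_mult_group\<close>,
        simp add: m_assoc)
  then show ?thesis
    using assms by (simp add: convolution_def cip_def)
qed

text \<open>The right side is the squared Hilbert-Schmidt norm of the operator. Each kernel row
  rearranges the values of \<open>f\<close>, so it has square norm \<open>sqn (carrier G) f\<close>;
  Bessel bounds its share of the sum, and there are \<open>card (carrier G)\<close> rows.\<close>

lemma sum_sqn_convolution_orthonormal_le:
  assumes on: "orthonormal (carrier G) m e"
  shows "(\<Sum>i<m. sqn (carrier G) (convolution f (e i)))
    \<le> real (card (carrier G)) * sqn (carrier G) f"
proof -
  let ?C = "carrier G"
  let ?k = "\<lambda>z w. cnj (f (z \<otimes> inv w))"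
  have "sqn ?C (?k z) = sqn ?C f" if "z \<in> ?C" for z
    using sum_inverse[of "\<lambda>w. (cmod (f (z \<otimes> w)))\<^sup>2"]
      sum_left_translate[OF that, of "\<lambda>w. (cmod (f w))\<^sup>2"]
    by (simp add: sqn_def)
  moreover have "cmod (convolution f (e i) z) = cmod (cip ?C (?k z) (e i))" if "z \<in> ?C" for i z
    unfolding convolution_eq_cip[OF that] by (subst cip_cnj[symmetric]) simp
  ultimately have "(\<Sum>i<m. (cmod (convolution f (e i) z))\<^sup>2) \<le> sqn ?C f" if "z \<in> ?C" for z
    using bessel[OF on, of "?k z"] that by simp
  then have "(\<Sum>z\<in>?C. \<Sum>i<m. (cmod (convolution f (e i) z))\<^sup>2) \<le> (\<Sum>z\<in>?C. sqn ?C f)"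
    by (rule sum_mono)
  moreover have "(\<Sum>i<m. sqn ?C (convolution f (e i))) =
      (\<Sum>z\<in>?C. \<Sum>i<m. (cmod (convolution f (e i) z))\<^sup>2)"
    unfolding sqn_def by (rule sum.swap)
  ultimately show ?thesis by simp
qed

text \<open>The bound stays valid for the junk values \<open>min_nontrivial_irrep_dim G = 0\<close> and \<open>x / 0 = 0\<close>: a
  nonzero convolution operator already produces a nontrivial irreducible representation.\<close>

lemma sqn_convolution_le:
  assumes mean: "(\<Sum>x\<in>carrier G. f x) = 0"
  shows "sqn (carrier G) (convolution f g) \<le>
    real (card (carrier G)) * sqn (carrier G) f * sqn (carrier G) g
      / real (min_nontrivial_irrep_dim G)"
proof -
  let ?C = "carrier G"
  let ?D = "min_nontrivial_irrep_dim G"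
  let ?h = "\<lambda>g. sqn ?C (convolution f g)"
  have ne: "?C \<noteq> {}"
    using one_closed by blast
  have "?h p = (\<Sum>z\<in>?C. (cmod (\<Sum>x\<in>?C. f x * p (inv x \<otimes> z)))\<^sup>2)" for p
    by (simp add: sqn_def convolution_def)
  then have "continuous_on UNIV ?h"
    by (simp only:) (intro continuous_intros; simp)
  then obtain g0 where g0: "\<And>x. x \<notin> ?C \<Longrightarrow> g0 x = 0" "sqn ?C g0 = 1"
    and max: "\<And>f. (\<And>x. x \<notin> ?C \<Longrightarrow> f x = 0) \<Longrightarrow> sqn ?C f = 1 \<Longrightarrow> ?h f \<le> ?h g0"
    using sqn_maximizer_exists[OF finite_carrier ne, of ?h] by blast
  \<comment> \<open>The squared operator norm of convolution by \<open>f\<close>.\<close>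
  define lam where "lam = ?h g0"
  have bound: "?h g \<le> lam * sqn ?C g" for g
  proof (cases "sqn ?C g = 0")
    case True
    then have "convolution f g = convolution f (\<lambda>_. 0)"
      using sqn_eq_0_iff[OF finite_carrier] by (intro convolution_cong) auto
    then show ?thesis
      using True by (simp add: convolution_def sqn_def cong: if_cong)
  next
    case False
    define s where "s = sqn ?C g"
    have s: "s > 0"
      unfolding s_def using False sqn_nonneg[of ?C g] by linarith
    define a where "a = complex_of_real (1 / sqrt s)"
    have a2: "(cmod a)\<^sup>2 = 1 / s"
      using s by (simp add: a_def norm_divide power_divide)
    \<comment> \<open>Maximality of \<open>g0\<close> concerns unit functions supported on the
      group, so \<open>g\<close> is rescaled and cut off; convolution does not see the
      cut-off.\<close>
    define g1 where "g1 = (\<lambda>x. if x \<in> ?C then a * g x else 0)"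
    have "sqn ?C g1 = sqn ?C (\<lambda>x. a * g x)"
      by (simp add: sqn_def g1_def)
    then have "sqn ?C g1 = 1"
      using s a2 by (simp add: sqn_scale s_def[symmetric])
    then have "?h g1 \<le> lam"
      unfolding lam_def by (intro max) (simp_all add: g1_def)
    moreover have "convolution f g1 = (\<lambda>z. a * convolution f g z)"
      unfolding convolution_scale[symmetric] by (rule convolution_cong) (simp add: g1_def)
    ultimately have "?h g / s \<le> lam"
      using a2 by (simp add: sqn_scale)
    then show ?thesis
      using s by (simp add: s_def[symmetric] field_simps)
  qed
  show ?thesis
  proof (cases "lam = 0")
    case True
    then have "?h g \<le> 0"
      using bound[of g] by simp
    moreover have "0 \<le> real (card ?C) * sqn ?C f * sqn ?C g / real ?D"
      by simp
    ultimately show ?thesis by linarith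
  next
    case False
    have lam_pos: "lam > 0"
      using False sqn_nonneg[of ?C "convolution f g0"] unfolding lam_def by linarith
    \<comment> \<open>The functions attaining equality in \<open>bound\<close>: the top eigenspace
      of the adjoint of the operator times the operator, described without adjoints.\<close>
    define V where "V = {g. (\<forall>x. x \<notin> ?C \<longrightarrow> g x = 0) \<and> ?h g = lam * sqn ?C g}"
    \<comment> \<open>Both summands of the parallelogram law are at most their bounds, and their sum is equal to
      the sum of the bounds.\<close>
    have V_add: "(\<lambda>x. p x + q x) \<in> V" if p: "p \<in> V" and q: "q \<in> V" for p q
    proof -
      have "?h (\<lambda>x. p x + q x) + ?h (\<lambda>x. p x - q x) = 2 * ?h p + 2 * ?h q"
        unfolding convolution_add convolution_diff by (rule sqn_parallelogram)
      also have "\<dots> = lam * (2 * sqn ?C p + 2 * sqn ?C q)"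
        using p q by (simp add: V_def algebra_simps)
      also have "\<dots> = lam * sqn ?C (\<lambda>x. p x + q x) + lam * sqn ?C (\<lambda>x. p x - q x)"
        unfolding sqn_parallelogram[symmetric] by (rule distrib_left)
      finally have "?h (\<lambda>x. p x + q x) = lam * sqn ?C (\<lambda>x. p x + q x)"
        using bound[of "\<lambda>x. p x + q x"] bound[of "\<lambda>x. p x - q x"] by linarith
      then show ?thesis
        using p q by (simp add: V_def)
    qed
    have "fun_subspace ?C V"
      unfolding fun_subspace_def
    proof (intro conjI ballI allI impI)
      show "(\<lambda>_. 0) \<in> V"
        by (simp add: V_def convolution_def sqn_def cong: if_cong)
    next
      fix a p assume "p \<in> V"
      then show "(\<lambda>x. a * p x) \<in> V"
        by (simp add: V_def convolution_scale sqn_scale)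
    qed (use V_add in \<open>auto simp: V_def\<close>)
    moreover have "right_translate a p \<in> V" if "a \<in> ?C" "p \<in> V" for a p
      using that
      by (simp add: V_def convolution_right_translate sqn_right_translate)
        (simp add: right_translate_def)
    ultimately have "invariant_subspace V"
      by (simp add: invariant_subspace_def)
    moreover have "V \<noteq> {\<lambda>_. 0}"
    proof
      assume "V = {\<lambda>_. 0}"
      moreover have "g0 \<in> V"
        using g0 by (simp add: V_def lam_def)
      ultimately have "g0 = (\<lambda>_. 0)" by blast
      then show False using g0(2) by (simp add: sqn_def)
    qed
    ultimately obtain W where W: "invariant_subspace W" "W \<noteq> {\<lambda>_. 0}" "W \<subseteq> V"
      and minimal: "\<And>U. invariant_subspace U \<Longrightarrow> U \<subseteq> W \<Longrightarrow> U = {\<lambda>_. 0} \<or> U = W"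
      by (rule minimal_invariant_subspace_exists) blast
    define m where "m = fun_dim ?C W"
    obtain \<rho> where irr: "is_irreducible_representation G m \<rho>"
      and triv: "is_trivial_representation G m \<rho> \<longrightarrow>
        (\<exists>w\<in>W. w \<noteq> (\<lambda>_. 0) \<and> (\<forall>a\<in>?C. right_translate a w = w))"
      unfolding m_def by (rule minimal_subspace_irreducible_rep[OF W(1,2) minimal]) blast
    \<comment> \<open>A translation-invariant function is constant, hence annihilated by convolution
      with the mean-zero \<open>f\<close>. In \<open>V\<close> with \<open>lam > 0\<close> this
      forces it to vanish.\<close>
    have nontriv: "\<not> is_trivial_representation G m \<rho>"
    proof
      assume "is_trivial_representation G m \<rho>"
      then obtain w where w: "w \<in> W" "w \<noteq> (\<lambda>_. 0)"
        and fixed: "\<And>a. a \<in> ?C \<Longrightarrow> right_translate a w = w"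
        using triv by blast
      have wV: "w \<in> V"
        using w W by blast
      have const: "w z = w \<one>" if "z \<in> ?C" for z
        using fun_cong[OF fixed[OF that], of \<one>] that by (simp add: right_translate_def)
      have "convolution f w = convolution f (\<lambda>_. w \<one>)"
        by (rule convolution_cong) (rule const)
      also have "\<dots> = (\<lambda>_. 0)"
        by (simp add: convolution_def sum_distrib_right[symmetric] mean cong: if_cong)
      finally have "?h w = 0"
        by (simp add: sqn_def)
      then have "sqn ?C w = 0"
        using wV lam_pos by (simp add: V_def)
      then have "w x = 0" for x
        using sqn_eq_0_iff[OF finite_carrier, of w] wV by (cases "x \<in> ?C") (auto simp: V_def)
      then show False
        using w(2) by blast
    qed
    have D_le: "?D \<le> m"
      unfolding min_nontrivial_irrep_dim_def using irr nontriv by (intro Least_le) blast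
    \<comment> \<open>Having found one candidate, the least dimension is attained; it is positive
      because irreducible representations have positive dimension.\<close>
    have "\<exists>\<rho>. is_irreducible_representation G ?D \<rho> \<and> \<not> is_trivial_representation G ?D \<rho>"
      unfolding min_nontrivial_irrep_dim_def by (rule LeastI_ex) (use irr nontriv in blast)
    then have D_pos: "0 < ?D"
      by (auto simp: is_irreducible_representation_def)
    obtain e where on: "orthonormal ?C m e" and eW: "\<And>i. i < m \<Longrightarrow> e i \<in> W"
      using fun_dim_greatest[OF finite_carrier, of W] unfolding m_def by blast
    \<comment> \<open>Each of the \<open>m\<close> unit vectors of \<open>W\<close> contributes the
      full \<open>lam\<close> to the Hilbert-Schmidt bound.\<close>
    have "?h (e i) = lam" if "i < m" for i
      using eW[OF that] W(3) orthonormal_sqn[OF on that] by (auto simp: V_def)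
    then have "real m * lam \<le> real (card ?C) * sqn ?C f"
      using sum_sqn_convolution_orthonormal_le[OF on, of f] by simp
    moreover have "real ?D * lam \<le> real m * lam"
      using D_le lam_pos by (intro mult_right_mono) auto
    ultimately have "lam \<le> real (card ?C) * sqn ?C f / real ?D"
      using D_pos by (simp add: field_simps)
    then have "lam * sqn ?C g \<le> real (card ?C) * sqn ?C f / real ?D * sqn ?C g"
      by (intro mult_right_mono) auto
    then show ?thesis
      using bound[of g] by simp
  qed
qed

end

subsection \<open>Unitary-valued functions\<close>

lemma norm_matrix_sq:
  fixes A :: "complex ^ 'n ^ 'm"
  shows "(norm A)\<^sup>2 = (\<Sum>i\<in>UNIV. \<Sum>j\<in>UNIV. (cmod (A $ i $ j))\<^sup>2)"
  by (simp add: norm_vec_def L2_set_def sum_nonneg)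

lemma norm_matrix_sq_columns:
  fixes A :: "complex ^ 'n ^ 'm"
  shows "(norm A)\<^sup>2 = (\<Sum>j\<in>UNIV. (norm (column j A))\<^sup>2)"
  unfolding norm_matrix_sq
  by (subst sum.swap) (simp add: norm_vec_def L2_set_def sum_nonneg column_def)

lemma matrix_mult_zero_left: "(0 :: complex ^ 'k ^ 'm) ** (A :: complex ^ 'n ^ 'k) = 0"
  by (simp add: matrix_matrix_mult_def vec_eq_iff)

lemma matrix_mult_zero_right: "(A :: complex ^ 'k ^ 'm) ** (0 :: complex ^ 'n ^ 'k) = 0"
  by (simp add: matrix_matrix_mult_def vec_eq_iff)

lemma matrix_mult_add_left:
  fixes A B :: "complex ^ 'k ^ 'm" and C :: "complex ^ 'n ^ 'k"
  shows "(A + B) ** C = A ** C + B ** C"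
  by (simp add: matrix_matrix_mult_def vec_eq_iff distrib_right sum.distrib)

lemma matrix_mult_sum_right:
  fixes A :: "complex ^ 'n ^ 'm" and F :: "'i \<Rightarrow> complex ^ 'k ^ 'n"
  shows "A ** (\<Sum>y\<in>S. F y) = (\<Sum>y\<in>S. A ** F y)"
  by (induction S rule: infinite_finite_induct)
    (simp_all add: matrix_mult_zero_right matrix_add_ldistrib)

lemma matrix_mult_sum_left:
  fixes A :: "complex ^ 'k ^ 'n" and F :: "'i \<Rightarrow> complex ^ 'n ^ 'm"
  shows "(\<Sum>y\<in>S. F y) ** A = (\<Sum>y\<in>S. F y ** A)"
  by (induction S rule: infinite_finite_induct)
    (simp_all add: matrix_mult_zero_left matrix_mult_add_left)

lemma conj_transpose_mult: "conj_transpose (A ** B) = conj_transpose B ** conj_transpose A"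
  by (simp add: conj_transpose_def matrix_matrix_mult_def vec_eq_iff mult.commute)

lemma unitary_mult:
  assumes "U \<in> unitary_group" "V \<in> unitary_group"
  shows "U ** V \<in> unitary_group"
proof -
  have "conj_transpose (U ** V) ** (U ** V) =
      conj_transpose V ** ((conj_transpose U ** U) ** V)"
    "(U ** V) ** conj_transpose (U ** V) =
      U ** ((V ** conj_transpose V) ** conj_transpose U)"
    by (simp_all add: conj_transpose_mult matrix_mul_assoc)
  then show ?thesis
    using assms by (simp add: unitary_group_def)
qed

lemma norm_unitary_sq:
  fixes U :: "complex ^ 'n ^ 'n"
  assumes "U \<in> unitary_group"
  shows "(norm U)\<^sup>2 = real CARD('n)"
proof -
  have "complex_of_real ((norm U)\<^sup>2) = trace (Finite_Cartesian_Product.mat 1 :: complex ^ 'n ^ 'n)"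
    using assms unfolding trace_conj_transpose_mult[symmetric] by (simp add: unitary_group_def)
  also have "\<dots> = complex_of_real (real CARD('n))"
    by (simp add: trace_def Finite_Cartesian_Product.mat_def)
  finally show ?thesis
    by (simp only: of_real_eq_iff)
qed

section \<open>Comparison of the Frobenius and operator norms\<close>

lemma norm_matrix_vector_le: "norm (A *v v) \<le> op_norm A * norm v"
  unfolding op_norm_def by (rule onorm) simp

lemma op_norm_nonneg: "0 \<le> op_norm A"
  unfolding op_norm_def by (rule onorm_pos_le) simp

text \<open>Column by column: the columns of \<open>A ** B\<close> are the images under
  \<open>A\<close> of the columns of \<open>B\<close>.\<close>

lemma norm_matrix_mult_le: "norm (A ** B) \<le> op_norm A * norm B"
proof (rule power2_le_imp_le)
  have col: "column j (A ** B) = A *v column j B" for j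
    by (simp add: column_def matrix_matrix_mult_def matrix_vector_mult_def vec_eq_iff)
  have "(norm (A ** B))\<^sup>2 \<le> (\<Sum>j\<in>UNIV. (op_norm A * norm (column j B))\<^sup>2)"
    unfolding norm_matrix_sq_columns[of "A ** B"] col
    by (intro sum_mono power_mono norm_matrix_vector_le) simp
  also have "\<dots> = (op_norm A * norm B)\<^sup>2"
    by (simp add: power_mult_distrib sum_distrib_left norm_matrix_sq_columns[of B])
  finally show "(norm (A ** B))\<^sup>2 \<le> (op_norm A * norm B)\<^sup>2" .
qed (simp add: op_norm_nonneg)

text \<open>The columns of \<open>A\<close> are the images of the standard unit vectors, so each has
  norm at most \<open>op_norm A\<close>.\<close>

lemma norm_matrix_sq_le_op_norm:
  fixes A :: "complex ^ 'n ^ 'n"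
  shows "(norm A)\<^sup>2 \<le> real CARD('n) * (op_norm A)\<^sup>2"
proof -
  have "A *v axis j 1 = column j A" for j
    by (simp add: column_def matrix_vector_mult_def vec_eq_iff axis_def if_distrib cong: if_cong)
  moreover have "norm (axis j (1 :: complex) :: complex ^ 'n) = 1" for j
    by (simp add: norm_vec_def L2_set_def axis_def if_distrib[of cmod] if_distrib[of "\<lambda>t. t\<^sup>2"]
        cong: if_cong)
  ultimately have "norm (column j A) \<le> op_norm A" for j
    using norm_matrix_vector_le[of A "axis j 1"] by simp
  then have "(norm A)\<^sup>2 \<le> (\<Sum>j\<in>(UNIV :: 'n set). (op_norm A)\<^sup>2)"
    unfolding norm_matrix_sq_columns by (intro sum_mono power_mono) auto
  then show ?thesis by simp
qed

text \<open>Here \<open>inner\<close> is the real part of the Hilbert-Schmidt product.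
  Cauchy-Schwarz leaves one operator norm and two Frobenius norms, and the latter cost a single
  factor of the dimension.\<close>

lemma inner_cube_le:
  fixes P :: "complex ^ 'n ^ 'n"
  shows "inner P (P ** P) \<le> real CARD('n) * op_norm P ^ 3"
proof -
  have "inner P (P ** P) \<le> norm P * norm (P ** P)"
    by (rule norm_cauchy_schwarz)
  also have "\<dots> \<le> norm P * (op_norm P * norm P)"
    by (intro mult_left_mono norm_matrix_mult_le) simp
  also have "\<dots> = op_norm P * (norm P)\<^sup>2"
    by (simp add: power2_eq_square)
  also have "\<dots> \<le> op_norm P * (real CARD('n) * (op_norm P)\<^sup>2)"
    by (intro mult_left_mono norm_matrix_sq_le_op_norm op_norm_nonneg)
  finally show ?thesis
    by (simp add: power2_eq_square power3_eq_cube mult_ac)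
qed

section \<open>Convolution of matrix-valued functions\<close>

context finite_group
begin

text \<open>Sums of this form are the entries of a matrix convolution. Minkowski and then
  Cauchy-Schwarz over \<open>j\<close> avoid a factor equal to the number of summands.\<close>

lemma sqn_sum_convolution_le:
  fixes f g :: "'j::finite \<Rightarrow> 'a \<Rightarrow> complex"
  assumes "\<And>j. (\<Sum>x\<in>carrier G. f j x) = 0"
  shows "sqn (carrier G) (\<lambda>z. \<Sum>j\<in>UNIV. convolution (f j) (g j) z) \<le>
    real (card (carrier G)) / real (min_nontrivial_irrep_dim G) *
      ((\<Sum>j\<in>UNIV. sqn (carrier G) (f j)) * (\<Sum>j\<in>UNIV. sqn (carrier G) (g j)))"
proof -
  let ?C = "carrier G"
  define r where "r = real (card ?C) / real (min_nontrivial_irrep_dim G)"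
  have r: "0 \<le> r" by (simp add: r_def)
  have "sqn ?C (convolution (f j) (g j)) \<le> r * (sqn ?C (f j) * sqn ?C (g j))" for j
    using sqn_convolution_le[OF assms, of j "g j"] by (simp add: r_def)
  then have "sqrt (sqn ?C (convolution (f j) (g j))) \<le>
      sqrt r * (sqrt (sqn ?C (f j)) * sqrt (sqn ?C (g j)))" for j
    by (simp flip: real_sqrt_mult)
  then have "(\<Sum>j\<in>UNIV. sqrt (sqn ?C (convolution (f j) (g j)))) \<le>
      sqrt r * (\<Sum>j\<in>UNIV. sqrt (sqn ?C (f j)) * sqrt (sqn ?C (g j)))"
    unfolding sum_distrib_left by (rule sum_mono)
  with L2_triangle_sum[of UNIV ?C "\<lambda>j. convolution (f j) (g j)"]
  have "sqrt (sqn ?C (\<lambda>z. \<Sum>j\<in>UNIV. convolution (f j) (g j) z)) \<le>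
      sqrt r * (\<Sum>j\<in>UNIV. sqrt (sqn ?C (f j)) * sqrt (sqn ?C (g j)))"
    by simp
  then have "(sqrt (sqn ?C (\<lambda>z. \<Sum>j\<in>UNIV. convolution (f j) (g j) z)))\<^sup>2 \<le>
      (sqrt r * (\<Sum>j\<in>UNIV. sqrt (sqn ?C (f j)) * sqrt (sqn ?C (g j))))\<^sup>2"
    by (rule power_mono) simp
  also have "\<dots> = r * (\<Sum>j\<in>UNIV. sqrt (sqn ?C (f j)) * sqrt (sqn ?C (g j)))\<^sup>2"
    using r by (simp add: power_mult_distrib)
  also have "\<dots> \<le> r * ((\<Sum>j\<in>UNIV. (sqrt (sqn ?C (f j)))\<^sup>2) * (\<Sum>j\<in>UNIV. (sqrt (sqn ?C (g j)))\<^sup>2))"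
    using r by (intro mult_left_mono Cauchy_Schwarz_ineq_sum)
  finally show ?thesis
    by (simp add: r_def)
qed

lemma sum_norm_sq_entries:
  fixes F :: "'a \<Rightarrow> complex ^ 'n ^ 'm"
  shows "(\<Sum>z\<in>S. (norm (F z))\<^sup>2) = (\<Sum>i\<in>UNIV. \<Sum>j\<in>UNIV. sqn S (\<lambda>z. F z $ i $ j))"
proof -
  have "(\<Sum>z\<in>S. (norm (F z))\<^sup>2) = (\<Sum>i\<in>UNIV. \<Sum>z\<in>S. \<Sum>j\<in>UNIV. (cmod (F z $ i $ j))\<^sup>2)"
    unfolding norm_matrix_sq by (rule sum.swap)
  also have "\<dots> = (\<Sum>i\<in>UNIV. \<Sum>j\<in>UNIV. \<Sum>z\<in>S. (cmod (F z $ i $ j))\<^sup>2)"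
    by (intro sum.cong refl sum.swap)
  finally show ?thesis by (simp add: sqn_def)
qed

text \<open>The bound for entry \<open>(i, k)\<close> is a product of a factor of row
  \<open>i\<close> and a factor of column \<open>k\<close>. Summing over all entries therefore gives
  the square of the total norm with no dimension factor.\<close>

lemma sum_norm_sq_matrix_convolution_le:
  fixes \<phi> :: "'a \<Rightarrow> complex ^ 'n ^ 'n"
  assumes mean: "(\<Sum>x\<in>carrier G. \<phi> x) = 0"
  shows "(\<Sum>z\<in>carrier G. (norm (\<Sum>x\<in>carrier G. \<phi> x ** \<phi> (inv x \<otimes> z)))\<^sup>2) \<le>
    real (card (carrier G)) / real (min_nontrivial_irrep_dim G) *
      (\<Sum>x\<in>carrier G. (norm (\<phi> x))\<^sup>2)\<^sup>2"
proof -
  let ?C = "carrier G"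
  define r where "r = real (card ?C) / real (min_nontrivial_irrep_dim G)"
  define s where "s i j = sqn ?C (\<lambda>z. \<phi> z $ i $ j)" for i j
  define H where "H z = (\<Sum>x\<in>?C. \<phi> x ** \<phi> (inv x \<otimes> z))" for z
  have mean_entry: "(\<Sum>x\<in>?C. \<phi> x $ i $ j) = 0" for i j
    using arg_cong[OF mean, of "\<lambda>A. A $ i $ j"] by simp
  have entry: "H z $ i $ k =
      (\<Sum>j\<in>UNIV. convolution (\<lambda>x. \<phi> x $ i $ j) (\<lambda>x. \<phi> x $ j $ k) z)"
    if "z \<in> ?C" for z i k
    using that by (simp add: H_def matrix_matrix_mult_def convolution_def) (rule sum.swap)
  have "sqn ?C (\<lambda>z. H z $ i $ k) \<le> r * ((\<Sum>j\<in>UNIV. s i j) * (\<Sum>j\<in>UNIV. s j k))" for i k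
  proof -
    have "sqn ?C (\<lambda>z. H z $ i $ k) =
        sqn ?C (\<lambda>z. \<Sum>j\<in>UNIV. convolution (\<lambda>x. \<phi> x $ i $ j) (\<lambda>x. \<phi> x $ j $ k) z)"
      by (simp add: sqn_def entry)
    also have "\<dots> \<le> r * ((\<Sum>j\<in>UNIV. s i j) * (\<Sum>j\<in>UNIV. s j k))"
      unfolding r_def s_def by (rule sqn_sum_convolution_le) (rule mean_entry)
    finally show ?thesis .
  qed
  then have "(\<Sum>z\<in>?C. (norm (H z))\<^sup>2) \<le>
      (\<Sum>i\<in>UNIV. \<Sum>k\<in>UNIV. r * ((\<Sum>j\<in>UNIV. s i j) * (\<Sum>j\<in>UNIV. s j k)))"
    unfolding sum_norm_sq_entries by (intro sum_mono)
  also have "\<dots> = r * ((\<Sum>i\<in>UNIV. \<Sum>j\<in>UNIV. s i j) * (\<Sum>k\<in>UNIV. \<Sum>j\<in>UNIV. s j k))"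
    unfolding sum_product sum_distrib_left[symmetric] ..
  also have "(\<Sum>k\<in>UNIV. \<Sum>j\<in>UNIV. s j k) = (\<Sum>j\<in>UNIV. \<Sum>k\<in>UNIV. s j k)"
    by (rule sum.swap)
  also have "(\<Sum>i\<in>UNIV. \<Sum>j\<in>UNIV. s i j) = (\<Sum>x\<in>?C. (norm (\<phi> x))\<^sup>2)"
    by (simp add: s_def sum_norm_sq_entries)
  finally show ?thesis
    by (simp only: H_def r_def power2_eq_square)
qed

text \<open>With \<open>z = x \<otimes> y\<close> the double sum pairs \<open>\<phi>\<close> with
  its own convolution; Cauchy-Schwarz over \<open>z\<close> and over matrix entries reduces it to
  the mixing bound.\<close>

lemma sum_inner_mean_zero_le:
  fixes \<phi> :: "'a \<Rightarrow> complex ^ 'n ^ 'n"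
  assumes mean: "(\<Sum>x\<in>carrier G. \<phi> x) = 0"
  defines "S \<equiv> \<Sum>x\<in>carrier G. (norm (\<phi> x))\<^sup>2"
  shows "(\<Sum>x\<in>carrier G. \<Sum>y\<in>carrier G. inner (\<phi> (x \<otimes> y)) (\<phi> x ** \<phi> y)) \<le>
    S * sqrt S * sqrt (real (card (carrier G)) / real (min_nontrivial_irrep_dim G))"
proof -
  let ?C = "carrier G"
  let ?r = "real (card ?C) / real (min_nontrivial_irrep_dim G)"
  define H where "H z = (\<Sum>x\<in>?C. \<phi> x ** \<phi> (inv x \<otimes> z))" for z
  have "(\<Sum>y\<in>?C. inner (\<phi> (x \<otimes> y)) (\<phi> x ** \<phi> y)) =
      (\<Sum>z\<in>?C. inner (\<phi> z) (\<phi> x ** \<phi> (inv x \<otimes> z)))" if "x \<in> ?C" for x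
    by (rule sum.reindex_bij_witness[of _ "\<lambda>z. inv x \<otimes> z" "\<lambda>y. x \<otimes> y"])
      (use that in \<open>auto simp: m_assoc[symmetric]\<close>)
  then have "(\<Sum>x\<in>?C. \<Sum>y\<in>?C. inner (\<phi> (x \<otimes> y)) (\<phi> x ** \<phi> y)) =
      (\<Sum>x\<in>?C. \<Sum>z\<in>?C. inner (\<phi> z) (\<phi> x ** \<phi> (inv x \<otimes> z)))"
    by simp
  also have "\<dots> = (\<Sum>z\<in>?C. inner (\<phi> z) (H z))"
    by (subst sum.swap) (simp add: H_def inner_sum_right)
  also have "\<dots> \<le> (\<Sum>z\<in>?C. \<bar>norm (\<phi> z)\<bar> * \<bar>norm (H z)\<bar>)"
    by (intro sum_mono) (simp add: norm_cauchy_schwarz)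
  also have "\<dots> \<le> L2_set (\<lambda>z. norm (\<phi> z)) ?C * L2_set (\<lambda>z. norm (H z)) ?C"
    by (rule L2_set_mult_ineq)
  also have "\<dots> \<le> sqrt S * sqrt (?r * S\<^sup>2)"
    using sum_norm_sq_matrix_convolution_le[OF mean]
    by (intro mult_mono) (auto simp: L2_set_def S_def H_def sum_nonneg)
  also have "\<dots> = S * sqrt S * sqrt ?r"
  proof -
    have "0 \<le> S"
      by (simp add: S_def sum_nonneg)
    then show ?thesis
      by (simp only: real_sqrt_mult real_sqrt_abs abs_of_nonneg mult_ac)
  qed
  finally show ?thesis .
qed

lemma sum_inner_decompose:
  fixes \<psi> \<phi> :: "'a \<Rightarrow> complex ^ 'n ^ 'n"
  assumes mean: "(\<Sum>x\<in>carrier G. \<phi> x) = 0"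
    and \<psi>: "\<And>x. x \<in> carrier G \<Longrightarrow> \<psi> x = P + \<phi> x"
  shows "(\<Sum>x\<in>carrier G. \<Sum>y\<in>carrier G. inner (\<psi> (x \<otimes> y)) (\<psi> x ** \<psi> y)) =
    (real (card (carrier G)))\<^sup>2 * inner P (P ** P) +
    (\<Sum>x\<in>carrier G. \<Sum>y\<in>carrier G. inner (\<phi> (x \<otimes> y)) (\<phi> x ** \<phi> y))"
proof -
  let ?C = "carrier G"
  let ?n = "real (card ?C)"
  have sum_\<psi>: "(\<Sum>x\<in>?C. \<psi> x) = ?n *\<^sub>R P"
    by (simp add: \<psi> sum.distrib mean sum_constant_scaleR del: sum_constant)
  have left: "(\<Sum>y\<in>?C. \<psi> (x \<otimes> y)) = ?n *\<^sub>R P" if "x \<in> ?C" for x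
    using sum_left_translate[OF that, of \<psi>] sum_\<psi> by simp
  have right: "(\<Sum>x\<in>?C. \<psi> (x \<otimes> y)) = ?n *\<^sub>R P" if "y \<in> ?C" for y
    using sum_right_translate[OF that, of \<psi>] sum_\<psi> by simp
  \<comment> \<open>The factor \<open>\<psi> (x \<otimes> y)\<close> stays whole in the first three
    terms, since summing it over one variable gives a multiple of \<open>P\<close>. The remaining
    sum of \<open>\<phi>\<close> then cancels the second and third terms.\<close>
  have "inner (\<psi> (x \<otimes> y)) (\<psi> x ** \<psi> y) =
      inner (\<psi> (x \<otimes> y)) (P ** P) + inner (\<psi> (x \<otimes> y)) (\<phi> x ** P) +
      inner (\<psi> (x \<otimes> y)) (P ** \<phi> y) + inner P (\<phi> x ** \<phi> y) +
      inner (\<phi> (x \<otimes> y)) (\<phi> x ** \<phi> y)" if "x \<in> ?C" "y \<in> ?C" for x y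
    using that
    by (simp add: \<psi> matrix_add_ldistrib matrix_mult_add_left inner_add_left inner_add_right)
  then have "(\<Sum>x\<in>?C. \<Sum>y\<in>?C. inner (\<psi> (x \<otimes> y)) (\<psi> x ** \<psi> y)) =
      (\<Sum>x\<in>?C. \<Sum>y\<in>?C. inner (\<psi> (x \<otimes> y)) (P ** P)) +
      (\<Sum>x\<in>?C. \<Sum>y\<in>?C. inner (\<psi> (x \<otimes> y)) (\<phi> x ** P)) +
      (\<Sum>x\<in>?C. \<Sum>y\<in>?C. inner (\<psi> (x \<otimes> y)) (P ** \<phi> y)) +
      (\<Sum>x\<in>?C. \<Sum>y\<in>?C. inner P (\<phi> x ** \<phi> y)) +
      (\<Sum>x\<in>?C. \<Sum>y\<in>?C. inner (\<phi> (x \<otimes> y)) (\<phi> x ** \<phi> y))"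
    by (simp add: sum.distrib)
  moreover have "(\<Sum>x\<in>?C. \<Sum>y\<in>?C. inner (\<psi> (x \<otimes> y)) (P ** P)) = ?n\<^sup>2 * inner P (P ** P)"
    by (simp only: inner_sum_left[symmetric] left cong: sum.cong)
      (simp add: power2_eq_square sum_constant_scaleR del: sum_constant)
  moreover have "(\<Sum>x\<in>?C. \<Sum>y\<in>?C. inner (\<psi> (x \<otimes> y)) (\<phi> x ** P)) = 0"
  proof -
    have "(\<Sum>x\<in>?C. \<Sum>y\<in>?C. inner (\<psi> (x \<otimes> y)) (\<phi> x ** P)) =
        (\<Sum>x\<in>?C. inner (?n *\<^sub>R P) (\<phi> x ** P))"
      by (simp only: inner_sum_left[symmetric] left cong: sum.cong)
    also have "\<dots> = inner (?n *\<^sub>R P) ((\<Sum>x\<in>?C. \<phi> x) ** P)"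
      by (simp only: inner_sum_right matrix_mult_sum_left)
    finally show ?thesis by (simp add: mean matrix_mult_zero_left)
  qed
  moreover have "(\<Sum>x\<in>?C. \<Sum>y\<in>?C. inner (\<psi> (x \<otimes> y)) (P ** \<phi> y)) = 0"
  proof -
    have "(\<Sum>x\<in>?C. \<Sum>y\<in>?C. inner (\<psi> (x \<otimes> y)) (P ** \<phi> y)) =
        (\<Sum>y\<in>?C. \<Sum>x\<in>?C. inner (\<psi> (x \<otimes> y)) (P ** \<phi> y))"
      by (rule sum.swap)
    also have "\<dots> = (\<Sum>y\<in>?C. inner (?n *\<^sub>R P) (P ** \<phi> y))"
      by (simp only: inner_sum_left[symmetric] right cong: sum.cong)
    also have "\<dots> = inner (?n *\<^sub>R P) (P ** (\<Sum>y\<in>?C. \<phi> y))"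
      by (simp only: inner_sum_right matrix_mult_sum_right)
    finally show ?thesis by (simp add: mean matrix_mult_zero_right)
  qed
  moreover have "(\<Sum>x\<in>?C. \<Sum>y\<in>?C. inner P (\<phi> x ** \<phi> y)) = 0"
    by (simp only: inner_sum_right[symmetric] matrix_mult_sum_right[symmetric] mean
        matrix_mult_zero_right inner_zero_right sum.neutral_const)
  ultimately show ?thesis by simp
qed

end

theorem theorem1:
  fixes G :: "('g, 'b) monoid_scheme" (structure)
    and \<psi> :: "'g \<Rightarrow> complex ^ 'd ^ 'd"
  assumes "group G"
    and "finite (carrier G)"
    and "carrier G \<noteq> {\<one>}"
    and "\<And>x. x \<in> carrier G \<Longrightarrow> \<psi> x \<in> unitary_group"
  shows "average (carrier G \<times> carrier G)
           (\<lambda>(x, y). (frobenius_norm (\<psi> (x \<otimes> y) - \<psi> x ** \<psi> y))\<^sup>2)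
         \<ge> 2 * real CARD('d) *
             (1 - (op_norm (average (carrier G) \<psi>)) ^ 3
                - sqrt (real CARD('d) / real (min_nontrivial_irrep_dim G)))"
proof -
  interpret finite_group G
    using assms(1,2) by (simp add: finite_group_def finite_group_axioms_def)
  let ?C = "carrier G"
  let ?d = "real CARD('d)"
  let ?D = "real (min_nontrivial_irrep_dim G)"
  define n where "n = real (card ?C)"
  have n: "n > 0"
    using finite_carrier one_closed by (auto simp: n_def card_gt_0_iff)
  define P where "P = average ?C \<psi>"
  define \<phi> where "\<phi> x = \<psi> x - P" for x
  define S where "S = (\<Sum>x\<in>?C. (norm (\<phi> x))\<^sup>2)"
  have "(\<Sum>x\<in>?C. \<psi> x) = n *\<^sub>R P"
    using n by (simp add: P_def average_def n_def)
  then have mean: "(\<Sum>x\<in>?C. \<phi> x) = 0"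
    by (simp add: \<phi>_def sum_subtractf sum_constant_scaleR n_def del: sum_constant)
  have \<psi>: "\<psi> x = P + \<phi> x" for x
    by (simp add: \<phi>_def)
  have norm_\<psi>: "(norm (\<psi> x))\<^sup>2 = ?d" if "x \<in> ?C" for x
    using assms(4)[OF that] by (rule norm_unitary_sq)
  \<comment> \<open>The variance is at most the second moment: the cross term vanishes because
    \<open>\<phi>\<close> has mean zero.\<close>
  have "S \<le> n * ?d"
  proof -
    have "(norm (\<psi> x))\<^sup>2 = (norm P)\<^sup>2 + 2 * inner P (\<phi> x) + (norm (\<phi> x))\<^sup>2" for x
      unfolding \<psi> power2_norm_eq_inner by (simp add: inner_add_left inner_add_right inner_commute)
    then have "(\<Sum>x\<in>?C. (norm (\<psi> x))\<^sup>2) = n * (norm P)\<^sup>2 + 2 * inner P (\<Sum>x\<in>?C. \<phi> x) + S"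
      by (simp add: sum.distrib S_def n_def inner_sum_right sum_distrib_left)
    moreover have "(\<Sum>x\<in>?C. (norm (\<psi> x))\<^sup>2) = n * ?d"
      by (simp add: norm_\<psi> n_def)
    ultimately show ?thesis
      using n by (simp add: mean)
  qed
  moreover have S: "0 \<le> S"
    by (simp add: S_def sum_nonneg)
  ultimately have "S * sqrt S * sqrt (n / ?D) \<le> (n * ?d) * sqrt (n * ?d) * sqrt (n / ?D)"
    using n by (intro mult_mono) auto
  \<comment> \<open>One factor \<open>n\<close> of the mixing bound joins the \<open>n\<close> from
    \<open>S\<close> under the root, leaving exactly the number \<open>n\<^sup>2\<close> of pairs in
    front.\<close>
  also have "\<dots> = (n * ?d) * sqrt (n\<^sup>2 * (?d / ?D))"
    by (simp add: power2_eq_square mult_ac flip: real_sqrt_mult)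
  also have "\<dots> = n\<^sup>2 * (?d * sqrt (?d / ?D))"
    using n by (simp only: real_sqrt_mult real_sqrt_abs) (simp add: power2_eq_square)
  finally have "(\<Sum>x\<in>?C. \<Sum>y\<in>?C. inner (\<phi> (x \<otimes> y)) (\<phi> x ** \<phi> y)) \<le>
      n\<^sup>2 * (?d * sqrt (?d / ?D))"
    using sum_inner_mean_zero_le[OF mean] by (simp add: S_def n_def)
  moreover have "n\<^sup>2 * inner P (P ** P) \<le> n\<^sup>2 * (?d * op_norm P ^ 3)"
    by (intro mult_left_mono inner_cube_le) simp
  ultimately have key: "(\<Sum>x\<in>?C. \<Sum>y\<in>?C. inner (\<psi> (x \<otimes> y)) (\<psi> x ** \<psi> y)) \<le>
      n\<^sup>2 * (?d * (op_norm P ^ 3 + sqrt (?d / ?D)))"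
    using sum_inner_decompose[OF mean \<psi>] by (simp add: n_def distrib_left)
  \<comment> \<open>Both \<open>\<psi> (x \<otimes> y)\<close> and
    \<open>\<psi> x ** \<psi> y\<close> are unitary, so each has square norm \<open>?d\<close> and
    only the inner product varies.\<close>
  have "(frobenius_norm (\<psi> (x \<otimes> y) - \<psi> x ** \<psi> y))\<^sup>2 =
      2 * ?d - 2 * inner (\<psi> (x \<otimes> y)) (\<psi> x ** \<psi> y)" if "x \<in> ?C" "y \<in> ?C" for x y
  proof -
    have "(norm (\<psi> x ** \<psi> y))\<^sup>2 = ?d"
      using assms(4) that by (intro norm_unitary_sq unitary_mult)
    moreover have "(norm (\<psi> (x \<otimes> y) - \<psi> x ** \<psi> y))\<^sup>2 =
        (norm (\<psi> (x \<otimes> y)))\<^sup>2 + (norm (\<psi> x ** \<psi> y))\<^sup>2 - 2 * inner (\<psi> (x \<otimes> y)) (\<psi> x ** \<psi> y)"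
      unfolding power2_norm_eq_inner by (simp add: inner_diff_left inner_diff_right inner_commute)
    ultimately show ?thesis
      using that by (simp add: frobenius_norm_eq_norm norm_\<psi>)
  qed
  then have "(\<Sum>(x, y)\<in>?C \<times> ?C. (frobenius_norm (\<psi> (x \<otimes> y) - \<psi> x ** \<psi> y))\<^sup>2) =
      (\<Sum>x\<in>?C. \<Sum>y\<in>?C. 2 * ?d - 2 * inner (\<psi> (x \<otimes> y)) (\<psi> x ** \<psi> y))"
    by (simp add: sum.cartesian_product[symmetric])
  also have "\<dots> = n\<^sup>2 * (2 * ?d) -
      2 * (\<Sum>x\<in>?C. \<Sum>y\<in>?C. inner (\<psi> (x \<otimes> y)) (\<psi> x ** \<psi> y))"
    by (simp add: sum_subtractf sum_distrib_left n_def power2_eq_square)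
  also have "\<dots> \<ge> n\<^sup>2 * (2 * ?d * (1 - op_norm P ^ 3 - sqrt (?d / ?D)))"
    using key by (simp add: algebra_simps)
  finally have "2 * ?d * (1 - op_norm P ^ 3 - sqrt (?d / ?D)) \<le>
      (\<Sum>(x, y)\<in>?C \<times> ?C. (frobenius_norm (\<psi> (x \<otimes> y) - \<psi> x ** \<psi> y))\<^sup>2) / n\<^sup>2"
    using n by (simp add: pos_le_divide_eq mult.commute)
  then show ?thesis
    unfolding P_def[symmetric]
    by (simp add: average_def[of "?C \<times> ?C"] card_cartesian_product n_def power2_eq_square)
qed

end
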